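(* Let $X$ and $Y$ be chains, let $X'\subseteq X$ and $Y'\subseteq Y$ with $|X'|>1$ and $|Y'|>1$, and suppose that $|X'|\geq 3$. Then the semigroups $T_{OP}(X,X')$ and $T_{OP}(Y,Y')$ are isomorphic if and only if there is a map $\theta$ from $X$ onto $Y$ that is an order-isomorphism or an order-anti-isomorphism and satisfies $(X')\theta=Y'$.
   Context: A chain is a totally ordered set. Maps are written on the right and composed from left to right. For a chain $X$ and a subset $X'\subseteq X$, $T_{OP}(X,X')$ is the semigroup under composition of all maps $\alpha:X\to X$ that are order-preserving ($x\le y$ implies $x\alpha\le y\alpha$) and whose range satisfies $\operatorname{ran}\alpha\subseteq X'$. An order-anti-isomorphism is an order-reversing bijection with order-reversing inverse. *)

theory Defs
  imports "HOL-Library.FuncSet"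
begin

text \<open>
  A chain is a subset of a type of class \<^class>\<open>linorder\<close> with the induced order.
  A map \<open>X \<rightarrow> X\<close> is a function that is extensional on \<open>X\<close> (undefined outside \<open>X\<close>), so that
  two elements of \<open>T_OP X X'\<close> are equal iff they agree on \<open>X\<close>.
\<close>

definition T_OP :: "'a::linorder set \<Rightarrow> 'a set \<Rightarrow> ('a \<Rightarrow> 'a) set" where
  "T_OP X X' = {\<alpha> \<in> X \<rightarrow>\<^sub>E X. mono_on X \<alpha> \<and> \<alpha> ` X \<subseteq> X'}"

text \<open>
  Maps are written on the right and composed from left to right: the product of
  \<open>\<alpha>\<close> and \<open>\<beta>\<close> applies \<open>\<alpha>\<close> first, so that \<open>x(\<alpha>\<beta>) = (x\<alpha>)\<beta>\<close>.
\<close>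

definition rcomp :: "'a set \<Rightarrow> ('a \<Rightarrow> 'a) \<Rightarrow> ('a \<Rightarrow> 'a) \<Rightarrow> 'a \<Rightarrow> 'a" where
  "rcomp X \<alpha> \<beta> = compose X \<beta> \<alpha>"

lemma rcomp_in_T_OP:
  assumes "X' \<subseteq> X" "\<alpha> \<in> T_OP X X'" "\<beta> \<in> T_OP X X'"
  shows "rcomp X \<alpha> \<beta> \<in> T_OP X X'"
proof -
  have \<alpha>: "\<And>x. x \<in> X \<Longrightarrow> \<alpha> x \<in> X" "mono_on X \<alpha>"
    and \<beta>: "\<And>x. x \<in> X \<Longrightarrow> \<beta> x \<in> X'" "mono_on X \<beta>"
    using assms by (auto simp: T_OP_def)
  have "mono_on X (rcomp X \<alpha> \<beta>)"
    using \<alpha> \<beta>(2) by (simp add: monotone_on_def rcomp_def compose_def)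
  moreover have "rcomp X \<alpha> \<beta> \<in> X \<rightarrow>\<^sub>E X"
    using \<alpha>(1) \<beta>(1) assms(1) by (auto simp: rcomp_def compose_def)
  moreover have "rcomp X \<alpha> \<beta> ` X \<subseteq> X'"
    using \<alpha>(1) \<beta>(1) by (auto simp: rcomp_def compose_def)
  ultimately show ?thesis
    by (simp add: T_OP_def)
qed

lemma rcomp_assoc:
  assumes "\<alpha> \<in> T_OP X X'"
  shows "rcomp X (rcomp X \<alpha> \<beta>) \<gamma> = rcomp X \<alpha> (rcomp X \<beta> \<gamma>)"
proof
  fix x
  have "\<alpha> x \<in> X" if "x \<in> X"
    using assms(1) that by (auto simp: T_OP_def)
  then show "rcomp X (rcomp X \<alpha> \<beta>) \<gamma> x = rcomp X \<alpha> (rcomp X \<beta> \<gamma>) x"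
    by (simp add: rcomp_def compose_def)
qed

text \<open>
  Isomorphism of semigroups given by a carrier set and a multiplication. The records of
  HOL-Algebra are not used because they carry an identity element, and \<open>T_OP X X'\<close>
  need not have one.
\<close>

definition semigroups_isomorphic ::
  "'s set \<Rightarrow> ('s \<Rightarrow> 's \<Rightarrow> 's) \<Rightarrow> 't set \<Rightarrow> ('t \<Rightarrow> 't \<Rightarrow> 't) \<Rightarrow> bool" where
  "semigroups_isomorphic S mult\<^sub>S T mult\<^sub>T \<longleftrightarrow>
     (\<exists>\<phi>. bij_betw \<phi> S T \<and> (\<forall>a\<in>S. \<forall>b\<in>S. \<phi> (mult\<^sub>S a b) = mult\<^sub>T (\<phi> a) (\<phi> b)))"

definition order_isomorphism ::
  "'a::linorder set \<Rightarrow> 'b::linorder set \<Rightarrow> ('a \<Rightarrow> 'b) \<Rightarrow> bool" where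
  "order_isomorphism X Y \<theta> \<longleftrightarrow>
     bij_betw \<theta> X Y \<and> mono_on X \<theta> \<and> mono_on Y (inv_into X \<theta>)"

definition order_anti_isomorphism ::
  "'a::linorder set \<Rightarrow> 'b::linorder set \<Rightarrow> ('a \<Rightarrow> 'b) \<Rightarrow> bool" where
  "order_anti_isomorphism X Y \<theta> \<longleftrightarrow>
     bij_betw \<theta> X Y \<and> antimono_on X \<theta> \<and> antimono_on Y (inv_into X \<theta>)"

end

theory Submission
  imports Defs
begin

text \<open>
  The point of the classification is that the chain \<open>X\<close>, with its subset \<open>X'\<close>, can be read off from
  the multiplication.

  Points of \<open>X'\<close> are the constant maps, and these are the right zeros. So an isomorphism \<open>\<phi>\<close> induces
  a bijection \<open>\<theta>\<close> from \<open>X'\<close> onto \<open>Y'\<close> that carries the action of \<open>\<alpha>\<close> on \<open>X'\<close> to the action of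
  \<open>\<phi> \<alpha>\<close> on \<open>Y'\<close> (\<open>ex_induced_action\<close>). A pair \<open>a < b\<close> can be moved to any pair \<open>c < d\<close> but to no
  pair \<open>c > d\<close>; hence \<open>\<theta>\<close> preserves all orientations or reverses all of them (\<open>\<theta>_monotone\<close>).

  A point \<open>x\<close> outside \<open>X'\<close> has no constant map. It is identified by its behaviour under all maps: it
  matches \<open>y\<close> if \<open>\<theta> (\<alpha> x) = \<phi> \<alpha> y\<close> for every \<open>\<alpha>\<close>. What has to be proved is that every \<open>x\<close> has a
  match. Maps with two values are cuts of the chain, and ranges are respected by \<open>\<phi>\<close>
  (\<open>range_image\<close>), so cuts correspond to cuts. When three values \<open>P, Q, R\<close> are available, inclusion
  of cuts is expressible by products (\<open>cut_inclusion\<close>). A point is a jump between two neighbouring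
  cuts, and a jump must go to a jump (\<open>ex_match_of_triple\<close>). Inclusion of cuts is needed because a
  chain may have cuts that no point realizes.

  Matching is then a bijection, by the same argument for the inverse of \<open>\<phi>\<close>; it extends \<open>\<theta>\<close> and
  inherits its orientation (\<open>ex_extension\<close>). The converse is conjugation
  (\<open>isomorphic_if_order_isomorphism\<close>).
\<close>

section \<open>Order-preserving maps with restricted range\<close>

lemma T_OP_I:
  assumes "X' \<subseteq> X" "\<And>x. x \<in> X \<Longrightarrow> f x \<in> X'"
    and "\<And>x y. x \<in> X \<Longrightarrow> y \<in> X \<Longrightarrow> x \<le> y \<Longrightarrow> f x \<le> f y"
  shows "restrict f X \<in> T_OP X X'"
  using assms by (auto simp: T_OP_def monotone_on_def)

lemma T_OP_app: "\<alpha> \<in> T_OP X X' \<Longrightarrow> x \<in> X \<Longrightarrow> \<alpha> x \<in> X'"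
  by (auto simp: T_OP_def)

lemma T_OP_mono: "\<alpha> \<in> T_OP X X' \<Longrightarrow> x \<in> X \<Longrightarrow> y \<in> X \<Longrightarrow> x \<le> y \<Longrightarrow> \<alpha> x \<le> \<alpha> y"
  by (auto simp: T_OP_def monotone_on_def)

lemma T_OP_eqI:
  assumes "\<alpha> \<in> T_OP X X'" "\<beta> \<in> T_OP X X'" "\<And>x. x \<in> X \<Longrightarrow> \<alpha> x = \<beta> x"
  shows "\<alpha> = \<beta>"
  using assms unfolding T_OP_def by (blast intro: PiE_ext)

lemma rcomp_app: "x \<in> X \<Longrightarrow> rcomp X \<alpha> \<beta> x = \<beta> (\<alpha> x)"
  by (simp add: rcomp_def compose_def)

text \<open>
  A product whose first factor is constant is constant, so an element that absorbs all
  left factors is constant; this singles out the constant maps by multiplication alone.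
\<close>

lemma constant_iff_right_zero:
  assumes "X' \<subseteq> X" "X' \<noteq> {}" "\<zeta> \<in> T_OP X X'"
  shows "(\<exists>a\<in>X'. \<zeta> = (\<lambda>x\<in>X. a)) \<longleftrightarrow> (\<forall>\<alpha>\<in>T_OP X X'. rcomp X \<alpha> \<zeta> = \<zeta>)"
proof
  assume "\<exists>a\<in>X'. \<zeta> = (\<lambda>x\<in>X. a)"
  then obtain a where a: "a \<in> X'" "\<zeta> = (\<lambda>x\<in>X. a)" by blast
  show "\<forall>\<alpha>\<in>T_OP X X'. rcomp X \<alpha> \<zeta> = \<zeta>"
  proof
    fix \<alpha> assume \<alpha>: "\<alpha> \<in> T_OP X X'"
    then have "\<alpha> x \<in> X" if "x \<in> X" for x
      using T_OP_app assms(1) that by blast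
    then show "rcomp X \<alpha> \<zeta> = \<zeta>"
      using a by (auto simp: rcomp_def compose_def)
  qed
next
  assume zero: "\<forall>\<alpha>\<in>T_OP X X'. rcomp X \<alpha> \<zeta> = \<zeta>"
  obtain a where a: "a \<in> X'" using assms by blast
  have "(\<lambda>x\<in>X. a) \<in> T_OP X X'"
    using assms a by (intro T_OP_I) auto
  then have "rcomp X (\<lambda>x\<in>X. a) \<zeta> = \<zeta>" using zero by blast
  moreover have "rcomp X (\<lambda>x\<in>X. a) \<zeta> = (\<lambda>x\<in>X. \<zeta> a)"
    by (auto simp: rcomp_def compose_def)
  ultimately have "\<zeta> = (\<lambda>x\<in>X. \<zeta> a)" by simp
  then show "\<exists>a\<in>X'. \<zeta> = (\<lambda>x\<in>X. a)"
    using T_OP_app[OF assms(3)] a assms(1) by blast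
qed

section \<open>Strictly monotone bijections\<close>

lemma order_isomorphismI:
  assumes "bij_betw h X Y" "strict_mono_on X h"
  shows "order_isomorphism X Y h"
proof -
  have h: "h ` X = Y" "inj_on h X" using assms(1) by (auto simp: bij_betw_def)
  have "inv_into X h u \<le> inv_into X h v" if uv: "u \<in> Y" "v \<in> Y" "u \<le> v" for u v
  proof (rule ccontr)
    assume "\<not> ?thesis"
    then have "h (inv_into X h v) < h (inv_into X h u)"
      using uv h by (intro monotone_onD[OF assms(2)]) (auto simp: inv_into_into)
    then show False using uv h by (simp add: f_inv_into_f)
  qed
  moreover have "mono_on X h"
    using assms(2) by (auto simp: monotone_on_def le_less)
  ultimately show ?thesis
    using assms by (auto simp: order_isomorphism_def monotone_on_def)
qed

lemma order_anti_isomorphismI: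
  assumes "bij_betw h X Y" "strict_antimono_on X h"
  shows "order_anti_isomorphism X Y h"
proof -
  have h: "h ` X = Y" "inj_on h X" using assms(1) by (auto simp: bij_betw_def)
  have "inv_into X h v \<le> inv_into X h u" if uv: "u \<in> Y" "v \<in> Y" "u \<le> v" for u v
  proof (rule ccontr)
    assume "\<not> ?thesis"
    then have "h (inv_into X h v) < h (inv_into X h u)"
      using uv h by (intro monotone_onD[OF assms(2)]) (auto simp: inv_into_into)
    then show False using uv h by (simp add: f_inv_into_f)
  qed
  moreover have "antimono_on X h"
    using assms(2) by (auto simp: monotone_on_def le_less)
  ultimately show ?thesis
    using assms by (auto simp: order_anti_isomorphism_def monotone_on_def)
qed

section \<open>Isomorphisms together with their action on the range sets\<close>

text \<open>
  The map \<open>\<theta>\<close> is the action of \<open>\<phi>\<close> on constant maps. It is a parameter rather than a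
  definition so that passing to the inverse isomorphism is an instance of the same locale.
\<close>

locale T_OP_isomorphism =
  fixes X X' :: "'a::linorder set" and Y Y' :: "'b::linorder set"
    and \<phi> :: "('a \<Rightarrow> 'a) \<Rightarrow> 'b \<Rightarrow> 'b" and \<theta> :: "'a \<Rightarrow> 'b"
  assumes X'_sub: "X' \<subseteq> X" and Y'_sub: "Y' \<subseteq> Y"
    and bij_\<phi>: "bij_betw \<phi> (T_OP X X') (T_OP Y Y')"
    and hom: "\<alpha> \<in> T_OP X X' \<Longrightarrow> \<beta> \<in> T_OP X X' \<Longrightarrow>
      \<phi> (rcomp X \<alpha> \<beta>) = rcomp Y (\<phi> \<alpha>) (\<phi> \<beta>)"
    and bij_\<theta>: "bij_betw \<theta> X' Y'"
    and equivariant: "\<alpha> \<in> T_OP X X' \<Longrightarrow> a \<in> X' \<Longrightarrow> \<phi> \<alpha> (\<theta> a) = \<theta> (\<alpha> a)"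
    and two_points: "\<exists>a\<in>X'. \<exists>b\<in>X'. a < b"
begin

lemma \<phi>_mem: "\<alpha> \<in> T_OP X X' \<Longrightarrow> \<phi> \<alpha> \<in> T_OP Y Y'"
  using bij_\<phi> by (auto simp: bij_betw_def)

lemma \<phi>_inj: "\<alpha> \<in> T_OP X X' \<Longrightarrow> \<beta> \<in> T_OP X X' \<Longrightarrow> \<phi> \<alpha> = \<phi> \<beta> \<Longrightarrow> \<alpha> = \<beta>"
  using bij_\<phi> by (auto simp: bij_betw_def inj_on_def)

lemma \<phi>_lift:
  assumes "\<alpha>' \<in> T_OP Y Y'"
  obtains \<alpha> where "\<alpha> \<in> T_OP X X'" "\<phi> \<alpha> = \<alpha>'"
proof -
  have "\<alpha>' \<in> \<phi> ` T_OP X X'" using assms bij_\<phi> by (simp add: bij_betw_def)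
  then show ?thesis using that by blast
qed

lemma \<theta>_mem: "a \<in> X' \<Longrightarrow> \<theta> a \<in> Y'"
  using bij_\<theta> by (auto simp: bij_betw_def)

lemma \<theta>_inj: "a \<in> X' \<Longrightarrow> b \<in> X' \<Longrightarrow> \<theta> a = \<theta> b \<longleftrightarrow> a = b"
  using bij_\<theta> by (auto simp: bij_betw_def inj_on_def)

lemma two_images: "\<exists>p\<in>Y'. \<exists>q\<in>Y'. p < q"
proof -
  obtain a b where "a \<in> X'" "b \<in> X'" "a < b" using two_points by blast
  then have "\<theta> a \<in> Y'" "\<theta> b \<in> Y'" "\<theta> a \<noteq> \<theta> b" by (auto simp: \<theta>_mem \<theta>_inj)
  then show ?thesis by (meson neqE)
qed

lemma inverse_isomorphism:
  "T_OP_isomorphism Y Y' X X' (inv_into (T_OP X X') \<phi>) (inv_into X' \<theta>)"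
proof
  let ?\<psi> = "inv_into (T_OP X X') \<phi>" and ?\<eta> = "inv_into X' \<theta>"
  have \<psi>: "?\<psi> \<alpha> \<in> T_OP X X'" "\<phi> (?\<psi> \<alpha>) = \<alpha>" if "\<alpha> \<in> T_OP Y Y'" for \<alpha>
    using that bij_\<phi> by (auto simp: bij_betw_def inv_into_into f_inv_into_f)
  have \<eta>: "?\<eta> a \<in> X'" "\<theta> (?\<eta> a) = a" if "a \<in> Y'" for a
    using that bij_\<theta> by (auto simp: bij_betw_def inv_into_into f_inv_into_f)
  show "Y' \<subseteq> Y" "X' \<subseteq> X" by (fact Y'_sub X'_sub)+
  show "bij_betw ?\<psi> (T_OP Y Y') (T_OP X X')" using bij_\<phi> by (rule bij_betw_inv_into)
  show "bij_betw ?\<eta> Y' X'" using bij_\<theta> by (rule bij_betw_inv_into)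
  show "\<exists>a\<in>Y'. \<exists>b\<in>Y'. a < b" by (rule two_images)
  fix \<alpha> assume \<alpha>: "\<alpha> \<in> T_OP Y Y'"
  show "?\<psi> (rcomp Y \<alpha> \<beta>) = rcomp X (?\<psi> \<alpha>) (?\<psi> \<beta>)" if \<beta>: "\<beta> \<in> T_OP Y Y'" for \<beta>
    by (rule \<phi>_inj) (simp_all add: \<psi> \<alpha> \<beta> hom rcomp_in_T_OP X'_sub Y'_sub)
  show "?\<psi> \<alpha> (?\<eta> a) = ?\<eta> (\<alpha> a)" if a: "a \<in> Y'" for a
  proof -
    have "\<alpha> a \<in> Y'" using T_OP_app \<alpha> a Y'_sub by blast
    moreover have "?\<psi> \<alpha> (?\<eta> a) \<in> X'" using T_OP_app \<psi>(1)[OF \<alpha>] \<eta>(1)[OF a] X'_sub by blast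
    moreover have "\<theta> (?\<psi> \<alpha> (?\<eta> a)) = \<alpha> a"
      using equivariant[OF \<psi>(1)[OF \<alpha>] \<eta>(1)[OF a]] by (simp add: \<psi> \<eta> \<alpha> a)
    ultimately show ?thesis by (metis \<eta> \<theta>_inj)
  qed
qed

text \<open>
  Some map takes \<open>a < b\<close> to \<open>c < d\<close>, so the orientation of the pair \<open>(\<theta> a, \<theta> b)\<close> is carried over
  to \<open>(\<theta> c, \<theta> d)\<close>: all pairs behave like one fixed pair.
\<close>

lemma \<theta>_monotone: "strict_mono_on X' \<theta> \<or> strict_antimono_on X' \<theta>"
proof -
  obtain a b where ab: "a \<in> X'" "b \<in> X'" "a < b" using two_points by blast
  have transfer: "(\<theta> a < \<theta> b \<longrightarrow> \<theta> c < \<theta> d) \<and> (\<theta> b < \<theta> a \<longrightarrow> \<theta> d < \<theta> c)"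
    if cd: "c \<in> X'" "d \<in> X'" "c < d" for c d
  proof -
    let ?\<alpha> = "\<lambda>x\<in>X. if x \<le> a then c else d"
    have mem: "?\<alpha> \<in> T_OP X X'"
      using cd X'_sub by (intro T_OP_I) auto
    have vals: "\<phi> ?\<alpha> (\<theta> a) = \<theta> c" "\<phi> ?\<alpha> (\<theta> b) = \<theta> d"
      using equivariant[OF mem ab(1)] equivariant[OF mem ab(2)] ab X'_sub by auto
    have "\<theta> a \<in> Y" "\<theta> b \<in> Y" using \<theta>_mem Y'_sub ab by auto
    then have "\<theta> a \<le> \<theta> b \<Longrightarrow> \<theta> c \<le> \<theta> d" "\<theta> b \<le> \<theta> a \<Longrightarrow> \<theta> d \<le> \<theta> c"
      using T_OP_mono[OF \<phi>_mem[OF mem]] vals by metis+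
    moreover have "\<theta> c \<noteq> \<theta> d" using \<theta>_inj cd by simp
    ultimately show ?thesis by (simp add: le_less)
  qed
  have "\<theta> a < \<theta> b \<or> \<theta> b < \<theta> a" using \<theta>_inj ab by (metis less_irrefl neqE)
  then show ?thesis
    using transfer by (auto simp: monotone_on_def)
qed

text \<open>
  Two cuts of \<open>Y\<close> at \<open>d\<close>, one leaving \<open>d\<close> above and one leaving it below, differ at \<open>d\<close> and nowhere
  else. Hence \<open>d\<close> lies in the range of a map exactly if the map has different products with them.
\<close>

lemma range_image_subset:
  assumes \<alpha>: "\<alpha> \<in> T_OP X X'"
  shows "\<theta> ` \<alpha> ` X \<subseteq> \<phi> \<alpha> ` Y"
proof (rule ccontr)
  assume "\<not> ?thesis"
  then obtain x where x: "x \<in> X" and miss: "\<theta> (\<alpha> x) \<notin> \<phi> \<alpha> ` Y" by blast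
  define d where "d = \<theta> (\<alpha> x)"
  have \<alpha>x: "\<alpha> x \<in> X'" using T_OP_app \<alpha> x by blast
  then have d: "d \<in> Y" unfolding d_def using \<theta>_mem Y'_sub by blast
  obtain p r where pr: "p \<in> Y'" "r \<in> Y'" "p < r" using two_images by blast
  define \<beta>' where "\<beta>' = (\<lambda>y\<in>Y. if y < d then p else r)"
  define \<gamma>' where "\<gamma>' = (\<lambda>y\<in>Y. if y \<le> d then p else r)"
  have \<beta>'\<gamma>': "\<beta>' \<in> T_OP Y Y'" "\<gamma>' \<in> T_OP Y Y'"
    unfolding \<beta>'_def \<gamma>'_def using Y'_sub pr by (auto intro!: T_OP_I)
  obtain \<beta> where \<beta>: "\<beta> \<in> T_OP X X'" "\<phi> \<beta> = \<beta>'" using \<phi>_lift \<beta>'\<gamma>'(1) .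
  obtain \<gamma> where \<gamma>: "\<gamma> \<in> T_OP X X'" "\<phi> \<gamma> = \<gamma>'" using \<phi>_lift \<beta>'\<gamma>'(2) .
  have "rcomp Y (\<phi> \<alpha>) \<beta>' = rcomp Y (\<phi> \<alpha>) \<gamma>'"
  proof (rule T_OP_eqI)
    fix y assume y: "y \<in> Y"
    have "\<phi> \<alpha> y \<noteq> d" using miss y d_def by (metis imageI)
    moreover have "\<phi> \<alpha> y \<in> Y" using T_OP_app[OF \<phi>_mem[OF \<alpha>] y] Y'_sub by blast
    ultimately show "rcomp Y (\<phi> \<alpha>) \<beta>' y = rcomp Y (\<phi> \<alpha>) \<gamma>' y"
      using y by (auto simp: rcomp_app \<beta>'_def \<gamma>'_def)
  qed (use \<beta>'\<gamma>' \<phi>_mem[OF \<alpha>] Y'_sub in \<open>auto intro: rcomp_in_T_OP\<close>)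
  then have "rcomp X \<alpha> \<beta> = rcomp X \<alpha> \<gamma>"
    using \<alpha> \<beta> \<gamma> X'_sub by (intro \<phi>_inj) (auto simp: hom rcomp_in_T_OP)
  then have "\<beta> (\<alpha> x) = \<gamma> (\<alpha> x)" using x by (metis rcomp_app)
  then have "\<beta>' d = \<gamma>' d"
    unfolding d_def using equivariant \<alpha>x \<beta> \<gamma> by metis
  then show False using pr d by (simp add: \<beta>'_def \<gamma>'_def)
qed

text \<open>
  The remaining inclusion is the previous lemma for the inverse isomorphism.
\<close>

lemma range_image:
  assumes \<alpha>: "\<alpha> \<in> T_OP X X'"
  shows "\<phi> \<alpha> ` Y = \<theta> ` \<alpha> ` X"
proof
  interpret inv: T_OP_isomorphism Y Y' X X' "inv_into (T_OP X X') \<phi>" "inv_into X' \<theta>"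
    by (rule inverse_isomorphism)
  have "inv_into (T_OP X X') \<phi> (\<phi> \<alpha>) = \<alpha>"
    using bij_\<phi> \<alpha> by (auto simp: bij_betw_def)
  then have sub: "inv_into X' \<theta> ` \<phi> \<alpha> ` Y \<subseteq> \<alpha> ` X"
    using inv.range_image_subset[OF \<phi>_mem[OF \<alpha>]] by simp
  show "\<phi> \<alpha> ` Y \<subseteq> \<theta> ` \<alpha> ` X"
  proof
    fix d assume d: "d \<in> \<phi> \<alpha> ` Y"
    then have "d \<in> Y'" using T_OP_app[OF \<phi>_mem[OF \<alpha>]] by blast
    then have "\<theta> (inv_into X' \<theta> d) = d"
      using bij_\<theta> by (auto simp: bij_betw_def f_inv_into_f)
    then show "d \<in> \<theta> ` \<alpha> ` X" using sub d by (metis image_eqI image_subset_iff)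
  qed
qed (rule range_image_subset[OF \<alpha>])

section \<open>Transporting points through cuts\<close>

text \<open>
  A chain of two cuts is a single map with three values, and both cuts are recovered from it by
  multiplying with maps that merge the middle value upwards or downwards. So inclusion of cuts is
  visible in the semigroup. This is where a third point of \<open>X'\<close> enters.
\<close>

lemma cut_inclusion:
  assumes PQR: "P \<in> X'" "Q \<in> X'" "R \<in> X'" "\<theta> P < \<theta> Q" "\<theta> Q < \<theta> R"
    and \<delta>: "\<delta> \<in> T_OP X X'" "\<delta> ` X \<subseteq> {P, R}"
    and \<eta>: "\<eta> \<in> T_OP X X'" "\<eta> ` X \<subseteq> {P, R}"
    and sub: "\<And>y. y \<in> Y \<Longrightarrow> \<phi> \<delta> y = \<theta> P \<Longrightarrow> \<phi> \<eta> y = \<theta> P"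
    and z: "z \<in> X" "\<delta> z = P"
  shows "\<eta> z = P"
proof -
  define p q r where "p = \<theta> P" "q = \<theta> Q" "r = \<theta> R"
  note pqr_def = this
  have pqr: "p < q" "q < r" "p < r" "p \<in> Y'" "q \<in> Y'" "r \<in> Y'" "p \<in> Y" "q \<in> Y" "r \<in> Y"
    using PQR \<theta>_mem Y'_sub less_trans[OF PQR(4,5)] by (auto simp: pqr_def)
  have val\<delta>: "\<phi> \<delta> y = p \<or> \<phi> \<delta> y = r" and val\<eta>: "\<phi> \<eta> y = p \<or> \<phi> \<eta> y = r" if "y \<in> Y" for y
    using range_image[OF \<delta>(1)] range_image[OF \<eta>(1)] \<delta>(2) \<eta>(2) that pqr_def by blast+
  define \<epsilon> where "\<epsilon> = (\<lambda>y\<in>Y. if \<phi> \<delta> y = p then p else if \<phi> \<eta> y = p then q else r)"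
  define \<beta>' where "\<beta>' = (\<lambda>y\<in>Y. if y < q then p else r)"
  define \<gamma>' where "\<gamma>' = (\<lambda>y\<in>Y. if y \<le> q then p else r)"
  have \<epsilon>: "\<epsilon> \<in> T_OP Y Y'"
    unfolding \<epsilon>_def
  proof (rule T_OP_I)
    fix y y' assume yy': "y \<in> Y" "y' \<in> Y" "y \<le> y'"
    have "\<phi> \<delta> y \<le> \<phi> \<delta> y'" "\<phi> \<eta> y \<le> \<phi> \<eta> y'"
      using T_OP_mono[OF \<phi>_mem] \<delta> \<eta> yy' by blast+
    then show "(if \<phi> \<delta> y = p then p else if \<phi> \<eta> y = p then q else r)
        \<le> (if \<phi> \<delta> y' = p then p else if \<phi> \<eta> y' = p then q else r)"
      using val\<delta>[OF yy'(1)] val\<delta>[OF yy'(2)] val\<eta>[OF yy'(1)] val\<eta>[OF yy'(2)] pqr(1-3)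
      by (elim disjE) (simp_all add: not_le[symmetric])
  qed (use pqr Y'_sub in auto)
  have \<beta>'\<gamma>': "\<beta>' \<in> T_OP Y Y'" "\<gamma>' \<in> T_OP Y Y'"
    unfolding \<beta>'_def \<gamma>'_def using Y'_sub pqr by (auto intro!: T_OP_I)
  obtain \<psi> where \<psi>: "\<psi> \<in> T_OP X X'" "\<phi> \<psi> = \<epsilon>" using \<phi>_lift \<epsilon> .
  obtain \<beta> where \<beta>: "\<beta> \<in> T_OP X X'" "\<phi> \<beta> = \<beta>'" using \<phi>_lift \<beta>'\<gamma>'(1) .
  obtain \<gamma> where \<gamma>: "\<gamma> \<in> T_OP X X'" "\<phi> \<gamma> = \<gamma>'" using \<phi>_lift \<beta>'\<gamma>'(2) .
  have "rcomp Y \<epsilon> \<beta>' = \<phi> \<delta>" "rcomp Y \<epsilon> \<gamma>' = \<phi> \<eta>"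
  proof -
    show "rcomp Y \<epsilon> \<beta>' = \<phi> \<delta>"
      by (rule T_OP_eqI[OF rcomp_in_T_OP[OF Y'_sub \<epsilon> \<beta>'\<gamma>'(1)] \<phi>_mem[OF \<delta>(1)]])
        (use val\<delta> pqr in \<open>force simp: rcomp_app \<epsilon>_def \<beta>'_def\<close>)
    show "rcomp Y \<epsilon> \<gamma>' = \<phi> \<eta>"
      by (rule T_OP_eqI[OF rcomp_in_T_OP[OF Y'_sub \<epsilon> \<beta>'\<gamma>'(2)] \<phi>_mem[OF \<eta>(1)]])
        (use val\<eta> sub pqr pqr_def in \<open>force simp: rcomp_app \<epsilon>_def \<gamma>'_def\<close>)
  qed
  then have eqs: "rcomp X \<psi> \<beta> = \<delta>" "rcomp X \<psi> \<gamma> = \<eta>"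
    using \<psi> \<beta> \<gamma> \<delta> \<eta> X'_sub by (auto intro!: \<phi>_inj simp: hom rcomp_in_T_OP)
  have "\<theta> (\<psi> z) \<in> \<epsilon> ` Y" using range_image[OF \<psi>(1)] \<psi>(2) z by blast
  then have "\<theta> (\<psi> z) \<in> {p, q, r}" by (auto simp: \<epsilon>_def split: if_splits)
  moreover have "\<psi> z \<in> X'" using T_OP_app \<psi>(1) z(1) by blast
  ultimately have "\<psi> z \<in> {P, Q, R}" using \<theta>_inj PQR by (auto simp: pqr_def)
  moreover have "\<beta> Q \<noteq> P" "\<beta> R \<noteq> P" "\<gamma> P = P"
  proof -
    have vals: "\<theta> (\<beta> a) = (if \<theta> a < q then p else r)" "\<theta> (\<gamma> a) = (if \<theta> a \<le> q then p else r)"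
      if "a \<in> X'" for a
      using subsetD[OF Y'_sub \<theta>_mem[OF that]]
      by (simp_all add: equivariant[OF \<beta>(1) that, symmetric] equivariant[OF \<gamma>(1) that, symmetric]
        \<beta>(2) \<gamma>(2) \<beta>'_def \<gamma>'_def)
    have "\<theta> (\<beta> Q) = r" "\<theta> (\<beta> R) = r" "\<theta> (\<gamma> P) = p"
      using PQR(1-3) pqr(1-3) by (auto simp: vals pqr_def[symmetric])
    moreover have "\<gamma> P \<in> X'" using T_OP_app \<gamma>(1) PQR X'_sub by blast
    ultimately show "\<beta> Q \<noteq> P" "\<beta> R \<noteq> P" "\<gamma> P = P" using pqr PQR \<theta>_inj by (auto simp: pqr_def)
  qed
  ultimately show ?thesis
    using eqs z by (metis empty_iff insert_iff rcomp_app)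
qed

text \<open>
  For \<open>x\<close> in \<open>X'\<close> the equivariance of \<open>\<theta>\<close> says that \<open>\<theta> x\<close> is a match. The relation extends this
  description to the points that no constant map represents.
\<close>

definition matches :: "'a \<Rightarrow> 'b \<Rightarrow> bool" where
  "matches x y \<longleftrightarrow> (\<forall>\<alpha>\<in>T_OP X X'. \<theta> (\<alpha> x) = \<phi> \<alpha> y)"

text \<open>
  The map \<open>\<alpha>\<close> below isolates \<open>x\<close>: merging its value \<open>Q\<close> with \<open>R\<close> or with \<open>P\<close> gives the two
  neighbouring cuts around \<open>x\<close>. Since inclusion of cuts is preserved, \<open>\<phi> \<alpha>\<close> takes the value
  \<open>\<theta> Q\<close> at a single point, and that point lies on the corresponding side of every cut.
  The orientation of \<open>P, Q, R\<close> in \<open>X\<close> is left open, which covers order-reversing \<open>\<theta>\<close> too.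
\<close>

lemma ex_match_of_triple:
  assumes x: "x \<in> X"
    and PQR: "P \<in> X'" "Q \<in> X'" "R \<in> X'" "\<theta> P < \<theta> Q" "\<theta> Q < \<theta> R"
    and between: "P < Q \<and> Q < R \<or> R < Q \<and> Q < P"
  shows "\<exists>y\<in>Y. matches x y"
proof -
  define p q r where "p = \<theta> P" "q = \<theta> Q" "r = \<theta> R"
  note pqr_def = this
  have pqr: "p < q" "q < r" "p < r" "p \<in> Y'" "q \<in> Y'" "r \<in> Y'" "p \<in> Y" "q \<in> Y" "r \<in> Y"
    using PQR \<theta>_mem Y'_sub less_trans[OF PQR(4,5)] by (auto simp: pqr_def)
  obtain \<alpha> where \<alpha>: "\<alpha> \<in> T_OP X X'" "\<alpha> x = Q"
    and \<alpha>_ne: "\<And>z. z \<in> X \<Longrightarrow> z \<noteq> x \<Longrightarrow> \<alpha> z = P \<or> \<alpha> z = R"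
  proof
    let ?\<alpha> = "\<lambda>z\<in>X. if z < x then min P R else if z = x then Q else max P R"
    show "?\<alpha> \<in> T_OP X X'"
      using PQR X'_sub between by (intro T_OP_I) (auto simp: min_def max_def)
    show "?\<alpha> x = Q" using x by simp
    show "?\<alpha> z = P \<or> ?\<alpha> z = R" if "z \<in> X" "z \<noteq> x" for z
      using that by (auto simp: min_def max_def)
  qed
  define \<beta>' where "\<beta>' = (\<lambda>y\<in>Y. if y < q then p else r)"
  define \<gamma>' where "\<gamma>' = (\<lambda>y\<in>Y. if y \<le> q then p else r)"
  have \<beta>'\<gamma>': "\<beta>' \<in> T_OP Y Y'" "\<gamma>' \<in> T_OP Y Y'"
    unfolding \<beta>'_def \<gamma>'_def using Y'_sub pqr by (auto intro!: T_OP_I)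
  obtain \<beta> where \<beta>: "\<beta> \<in> T_OP X X'" "\<phi> \<beta> = \<beta>'" using \<phi>_lift \<beta>'\<gamma>'(1) .
  obtain \<gamma> where \<gamma>: "\<gamma> \<in> T_OP X X'" "\<phi> \<gamma> = \<gamma>'" using \<phi>_lift \<beta>'\<gamma>'(2) .
  have in_X': "\<beta> a \<in> X'" "\<gamma> a \<in> X'" if "a \<in> X'" for a
    using T_OP_app[OF \<beta>(1)] T_OP_app[OF \<gamma>(1)] X'_sub that by blast+
  have vals: "\<theta> (\<beta> a) = (if \<theta> a < q then p else r)" "\<theta> (\<gamma> a) = (if \<theta> a \<le> q then p else r)"
    if "a \<in> X'" for a
    using subsetD[OF Y'_sub \<theta>_mem[OF that]]
    by (simp_all add: equivariant[OF \<beta>(1) that, symmetric] equivariant[OF \<gamma>(1) that, symmetric]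
        \<beta>(2) \<gamma>(2) \<beta>'_def \<gamma>'_def)
  have \<theta>\<beta>\<gamma>: "\<theta> (\<beta> P) = p" "\<theta> (\<beta> Q) = r" "\<theta> (\<beta> R) = r"
      "\<theta> (\<gamma> P) = p" "\<theta> (\<gamma> Q) = p" "\<theta> (\<gamma> R) = r"
    using PQR(1-3) pqr(1-3) by (auto simp: vals pqr_def[symmetric])
  have \<beta>\<gamma>: "\<beta> P = P" "\<beta> Q = R" "\<beta> R = R" "\<gamma> P = P" "\<gamma> Q = P" "\<gamma> R = R"
    using \<theta>\<beta>\<gamma> in_X' PQR \<theta>_inj unfolding pqr_def by blast+
  define lower where "lower = rcomp X \<alpha> \<beta>"
  define upper where "upper = rcomp X \<alpha> \<gamma>"
  have mem: "lower \<in> T_OP X X'" "upper \<in> T_OP X X'"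
    using \<alpha> \<beta> \<gamma> X'_sub by (auto simp: lower_def upper_def rcomp_in_T_OP)
  have at_x: "lower x = R" "upper x = P"
    using x \<alpha> \<beta>\<gamma> by (auto simp: lower_def upper_def rcomp_app)
  have off_x: "lower z = \<alpha> z" "upper z = \<alpha> z" if "z \<in> X" "z \<noteq> x" for z
    using \<alpha>_ne[OF that] \<beta>\<gamma> that by (auto simp: lower_def upper_def rcomp_app)
  have sub: "lower ` X \<subseteq> {P, R}" "upper ` X \<subseteq> {P, R}"
    using at_x off_x \<alpha>_ne by (metis image_subsetI insertCI)+
  have \<phi>\<alpha>: "\<phi> \<alpha> y = p \<or> \<phi> \<alpha> y = q \<or> \<phi> \<alpha> y = r" if y: "y \<in> Y" for y
  proof -
    obtain z where "z \<in> X" "\<phi> \<alpha> y = \<theta> (\<alpha> z)"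
      using range_image[OF \<alpha>(1)] y by blast
    then show ?thesis using \<alpha>(2) \<alpha>_ne[of z] by (cases "z = x") (auto simp: pqr_def)
  qed
  have \<phi>_cut: "\<phi> lower y = (if \<phi> \<alpha> y = p then p else r)"
      "\<phi> upper y = (if \<phi> \<alpha> y = r then r else p)" if "y \<in> Y" for y
    using \<phi>\<alpha>[OF that] pqr that \<alpha> \<beta> \<gamma>
    by (auto simp: lower_def upper_def hom rcomp_app \<beta>'_def \<gamma>'_def)
  obtain y where y: "y \<in> Y" "\<phi> \<alpha> y = q"
  proof -
    have "q \<in> \<phi> \<alpha> ` Y" unfolding range_image[OF \<alpha>(1)] using \<alpha>(2) x by (auto simp: pqr_def)
    then show ?thesis using that by blast
  qed
  have no_two: False if uv: "u \<in> Y" "v \<in> Y" "u < v" "\<phi> \<alpha> u = q" "\<phi> \<alpha> v = q" for u v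
  proof -
    \<comment> \<open>A cut between \<open>u\<close> and \<open>v\<close> comes from a cut between the two neighbouring cuts at \<open>x\<close>,
      hence equal to one of them.\<close>
    define \<delta>' where "\<delta>' = (\<lambda>y\<in>Y. if y \<le> u then p else r)"
    have "\<delta>' \<in> T_OP Y Y'"
      unfolding \<delta>'_def using Y'_sub pqr by (auto intro!: T_OP_I)
    then obtain \<delta> where \<delta>: "\<delta> \<in> T_OP X X'" "\<phi> \<delta> = \<delta>'" using \<phi>_lift by blast
    have \<delta>_sub: "\<delta> ` X \<subseteq> {P, R}"
    proof
      fix d assume d: "d \<in> \<delta> ` X"
      then have "\<theta> d \<in> \<delta>' ` Y" using range_image[OF \<delta>(1)] \<delta>(2) by blast
      then have "\<theta> d = \<theta> P \<or> \<theta> d = \<theta> R" by (auto simp: \<delta>'_def pqr_def split: if_splits)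
      moreover have "d \<in> X'" using d T_OP_app[OF \<delta>(1)] by blast
      ultimately show "d \<in> {P, R}" using \<theta>_inj PQR by blast
    qed
    have low: "\<delta> z = P" if "z \<in> X" "lower z = P" for z
    proof (rule cut_inclusion[OF PQR mem(1) sub(1) \<delta>(1) \<delta>_sub _ that])
      fix w assume w: "w \<in> Y" "\<phi> lower w = \<theta> P"
      then have "\<phi> \<alpha> w = p" using \<phi>_cut pqr by (auto simp: pqr_def[symmetric] split: if_splits)
      then have "\<not> u \<le> w" using T_OP_mono[OF \<phi>_mem[OF \<alpha>(1)], of u w] uv w pqr by auto
      then show "\<phi> \<delta> w = \<theta> P" using w(1) \<delta>(2) by (auto simp: \<delta>'_def pqr_def)
    qed
    have up: "upper z = P" if "z \<in> X" "\<delta> z = P" for z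
    proof (rule cut_inclusion[OF PQR \<delta>(1) \<delta>_sub mem(2) sub(2) _ that])
      fix w assume w: "w \<in> Y" "\<phi> \<delta> w = \<theta> P"
      then have "w \<le> u" using \<delta> pqr by (auto simp: \<delta>'_def pqr_def[symmetric] split: if_splits)
      then have "\<phi> \<alpha> w \<le> q" using T_OP_mono[OF \<phi>_mem[OF \<alpha>(1)], of w u] uv w by auto
      then show "\<phi> upper w = \<theta> P" using w \<phi>_cut pqr by (auto simp: pqr_def[symmetric])
    qed
    have agree: "\<delta> z = \<alpha> z" if z: "z \<in> X" "z \<noteq> x" for z
      using low[OF z(1)] up[OF z(1)] off_x[OF z] \<alpha>_ne[OF z] \<delta>_sub z(1) by auto
    have "\<delta> x = P \<or> \<delta> x = R" using \<delta>_sub x by blast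
    then have "\<delta> = upper \<or> \<delta> = lower"
      using T_OP_eqI[OF \<delta>(1) mem(1)] T_OP_eqI[OF \<delta>(1) mem(2)] agree off_x at_x by metis
    then have "\<delta>' u = \<phi> upper u \<and> \<delta>' v = \<phi> upper v \<or> \<delta>' u = \<phi> lower u \<and> \<delta>' v = \<phi> lower v"
      using \<delta>(2) by blast
    moreover have "\<delta>' u = p" "\<delta>' v = r"
      using uv(1-2) uv(3)[folded not_le] by (simp_all add: \<delta>'_def)
    moreover have "\<phi> lower u = r" "\<phi> upper v = p"
      using \<phi>_cut(1)[OF uv(1)] \<phi>_cut(2)[OF uv(2)] uv(4,5) pqr(1,2) by auto
    ultimately show False using pqr(3) by (metis less_irrefl)
  qed
  have below: "\<phi> \<alpha> w = p" if w: "w \<in> Y" "w < y" for w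
  proof -
    have "\<phi> \<alpha> w \<le> q" "\<phi> \<alpha> w \<noteq> q"
      using T_OP_mono[OF \<phi>_mem[OF \<alpha>(1)], of w y] no_two[of w y] w y by auto
    then show ?thesis using \<phi>\<alpha>[OF w(1)] pqr(2)[folded not_le] by metis
  qed
  have above: "\<phi> \<alpha> w = r" if w: "w \<in> Y" "y < w" for w
  proof -
    have "q \<le> \<phi> \<alpha> w" "\<phi> \<alpha> w \<noteq> q"
      using T_OP_mono[OF \<phi>_mem[OF \<alpha>(1)], of y w] no_two[of y w] w y by auto
    then show ?thesis using \<phi>\<alpha>[OF w(1)] pqr(1)[folded not_le] by metis
  qed
  have cuts: "\<theta> (\<delta> x) = \<phi> \<delta> y" if \<delta>: "\<delta> \<in> T_OP X X'" "\<delta> ` X \<subseteq> {P, R}" for \<delta>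
  proof -
    have val: "\<phi> \<delta> w = p \<or> \<phi> \<delta> w = r" if "w \<in> Y" for w
      using range_image[OF \<delta>(1)] \<delta>(2) that pqr_def by blast
    have mono: "\<phi> \<delta> v \<le> \<phi> \<delta> w" if "v \<in> Y" "w \<in> Y" "v \<le> w" for v w
      using T_OP_mono[OF \<phi>_mem[OF \<delta>(1)]] that by blast
    have "\<delta> x = P \<longleftrightarrow> \<phi> \<delta> y = p"
    proof
      assume \<delta>x: "\<delta> x = P"
      show "\<phi> \<delta> y = p"
      proof (rule ccontr)
        assume ne: "\<phi> \<delta> y \<noteq> p"
        have "lower x = P"
        proof (rule cut_inclusion[OF PQR \<delta> mem(1) sub(1) _ x \<delta>x])
          fix w assume w: "w \<in> Y" "\<phi> \<delta> w = \<theta> P"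
          then have "w < y" using mono[of y w] val[OF y(1)] ne y pqr
            by (auto simp: pqr_def[symmetric] not_le[symmetric])
          then show "\<phi> lower w = \<theta> P" using below w \<phi>_cut by (simp add: pqr_def)
        qed
        then show False using at_x PQR by auto
      qed
    next
      assume \<delta>y: "\<phi> \<delta> y = p"
      show "\<delta> x = P"
      proof (rule cut_inclusion[OF PQR mem(2) sub(2) \<delta> _ x at_x(2)])
        fix w assume w: "w \<in> Y" "\<phi> upper w = \<theta> P"
        then have "w \<le> y" using above[OF w(1)] \<phi>_cut(2)[OF w(1)] pqr
          by (auto simp: pqr_def[symmetric] not_less[symmetric])
        then show "\<phi> \<delta> w = \<theta> P" using mono[of w y] val[OF w(1)] w y \<delta>y pqr
          by (auto simp: pqr_def[symmetric])
      qed
    qed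
    then show ?thesis
      using val[OF y(1)] \<delta>(2) x PQR pqr by (auto simp: pqr_def)
  qed
  have "matches x y"
    unfolding matches_def
  proof (intro ballI, rule ccontr)
    fix \<delta> assume \<delta>: "\<delta> \<in> T_OP X X'" and ne: "\<theta> (\<delta> x) \<noteq> \<phi> \<delta> y"
    \<comment> \<open>Two different values are separated by a cut, which reduces the claim to maps with two values.\<close>
    define \<kappa>' where "\<kappa>' = (\<lambda>w\<in>Y. if w \<le> min (\<theta> (\<delta> x)) (\<phi> \<delta> y) then p else r)"
    have "\<kappa>' \<in> T_OP Y Y'"
      unfolding \<kappa>'_def using Y'_sub pqr by (auto intro!: T_OP_I simp del: min_less_iff_conj min.bounded_iff)
    then obtain \<kappa> where \<kappa>: "\<kappa> \<in> T_OP X X'" "\<phi> \<kappa> = \<kappa>'" using \<phi>_lift by blast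
    have \<delta>\<kappa>: "rcomp X \<delta> \<kappa> \<in> T_OP X X'" using rcomp_in_T_OP X'_sub \<delta> \<kappa> by blast
    have \<delta>X: "\<delta> z \<in> X'" if "z \<in> X" for z using T_OP_app \<delta> that by blast
    have "rcomp X \<delta> \<kappa> ` X \<subseteq> {P, R}"
    proof
      fix d assume d: "d \<in> rcomp X \<delta> \<kappa> ` X"
      then obtain z where z: "z \<in> X" "d = \<kappa> (\<delta> z)" by (auto simp: rcomp_app)
      have "\<theta> d \<in> \<kappa>' ` Y" using range_image[OF \<kappa>(1)] \<kappa>(2) z \<delta>X X'_sub by blast
      then have "\<theta> d = \<theta> P \<or> \<theta> d = \<theta> R" by (auto simp: \<kappa>'_def pqr_def split: if_splits)
      moreover have "d \<in> X'" using d T_OP_app[OF \<delta>\<kappa>] by blast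
      ultimately show "d \<in> {P, R}" using \<theta>_inj PQR by blast
    qed
    then have "\<theta> (\<kappa> (\<delta> x)) = \<kappa>' (\<phi> \<delta> y)"
      using cuts[OF \<delta>\<kappa>] x y by (simp add: rcomp_app hom \<delta> \<kappa>)
    then have "\<kappa>' (\<theta> (\<delta> x)) = \<kappa>' (\<phi> \<delta> y)"
      using equivariant[OF \<kappa>(1) \<delta>X[OF x]] \<kappa>(2) by simp
    moreover have "\<theta> (\<delta> x) \<in> Y" "\<phi> \<delta> y \<in> Y"
      using \<theta>_mem[OF \<delta>X[OF x]] T_OP_app[OF \<phi>_mem[OF \<delta>] y(1)] Y'_sub by auto
    ultimately show False
      using ne pqr by (auto simp: \<kappa>'_def min_def split: if_splits)
  qed
  then show ?thesis using y by blast
qed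

lemma ex_match:
  assumes "x \<in> X" "a \<in> X'" "b \<in> X'" "c \<in> X'" "a < b" "b < c"
  shows "\<exists>y\<in>Y. matches x y"
  using \<theta>_monotone
proof
  assume "strict_mono_on X' \<theta>"
  then show ?thesis
    using assms by (intro ex_match_of_triple[of x a b c]) (auto simp: monotone_on_def)
next
  assume "strict_antimono_on X' \<theta>"
  then show ?thesis
    using assms by (intro ex_match_of_triple[of x c b a]) (auto simp: monotone_on_def)
qed

text \<open>
  Cuts separate points, so a match preserves whatever orientation \<open>\<theta>\<close> has on the two values of a
  cut between them.
\<close>

lemma matches_order:
  assumes "matches x y" "matches x' y'" "x \<in> X" "x' \<in> X" "y \<in> Y" "y' \<in> Y" "x < x'"
  shows "strict_mono_on X' \<theta> \<Longrightarrow> y < y'" "strict_antimono_on X' \<theta> \<Longrightarrow> y' < y"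
proof -
  obtain a b where ab: "a \<in> X'" "b \<in> X'" "a < b" using two_points by blast
  let ?\<alpha> = "\<lambda>z\<in>X. if z \<le> x then a else b"
  have mem: "?\<alpha> \<in> T_OP X X'" using ab X'_sub by (intro T_OP_I) auto
  have vals: "\<phi> ?\<alpha> y = \<theta> a" "\<phi> ?\<alpha> y' = \<theta> b"
    using assms(1)[unfolded matches_def, rule_format, OF mem]
      assms(2)[unfolded matches_def, rule_format, OF mem] assms(3,4)
    by (simp_all add: assms(7)[folded not_le])
  have mono: "\<And>u v. u \<in> Y \<Longrightarrow> v \<in> Y \<Longrightarrow> u \<le> v \<Longrightarrow> \<phi> ?\<alpha> u \<le> \<phi> ?\<alpha> v"
    using T_OP_mono[OF \<phi>_mem[OF mem]] .
  show "y < y'" if "strict_mono_on X' \<theta>"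
    using mono[of y' y] that ab vals assms by (force simp: monotone_on_def)
  show "y' < y" if "strict_antimono_on X' \<theta>"
    using mono[of y y'] that ab vals assms by (force simp: monotone_on_def)
qed

lemma matches_unique:
  assumes "matches x y" "matches x y'" "y \<in> Y" "y' \<in> Y"
  shows "y = y'"
proof -
  have False if uv: "matches x u" "matches x v" "u \<in> Y" "v \<in> Y" "u < v" for u v
  proof -
    obtain p r where pr: "p \<in> Y'" "r \<in> Y'" "p < r" using two_images by blast
    let ?\<alpha> = "\<lambda>w\<in>Y. if w \<le> u then p else r"
    have "?\<alpha> \<in> T_OP Y Y'" using pr Y'_sub by (intro T_OP_I) auto
    then obtain \<alpha> where "\<alpha> \<in> T_OP X X'" "\<phi> \<alpha> = ?\<alpha>" using \<phi>_lift by blast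
    then have "?\<alpha> u = ?\<alpha> v" using uv by (metis matches_def)
    then show False using uv pr by (simp split: if_splits)
  qed
  then show ?thesis using assms by (meson neqE)
qed

end

context T_OP_isomorphism
begin

text \<open>
  Every point of \<open>Y\<close> is hit because matching for the inverse isomorphism is the converse relation.
\<close>

lemma ex_extension:
  assumes abc: "a \<in> X'" "b \<in> X'" "c \<in> X'" "a < b" "b < c"
  shows "\<exists>h. (order_isomorphism X Y h \<or> order_anti_isomorphism X Y h) \<and> h ` X' = Y'"
proof -
  interpret inv: T_OP_isomorphism Y Y' X X' "inv_into (T_OP X X') \<phi>" "inv_into X' \<theta>"
    by (rule inverse_isomorphism)
  obtain h where h: "\<And>x. x \<in> X \<Longrightarrow> h x \<in> Y" "\<And>x. x \<in> X \<Longrightarrow> matches x (h x)"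
    using ex_match[OF _ abc] by metis
  have inv_matches: "inv.matches y x \<longleftrightarrow> matches x y" if xy: "x \<in> X" "y \<in> Y" for x y
  proof -
    have "\<theta> (\<alpha> x) = \<phi> \<alpha> y \<longleftrightarrow> inv_into X' \<theta> (\<phi> \<alpha> y) = \<alpha> x" if \<alpha>: "\<alpha> \<in> T_OP X X'" for \<alpha>
    proof -
      have "\<alpha> x \<in> X'" "\<phi> \<alpha> y \<in> Y'" using T_OP_app \<alpha> \<phi>_mem xy by blast+
      then show ?thesis using bij_\<theta>
        by (metis bij_betw_inv_into_left bij_betw_inv_into_right)
    qed
    moreover have "inv.matches y x \<longleftrightarrow>
        (\<forall>\<alpha>\<in>T_OP X X'. inv_into X' \<theta> (\<phi> \<alpha> y) = inv_into (T_OP X X') \<phi> (\<phi> \<alpha>) x)"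
      unfolding inv.matches_def bij_betw_imp_surj_on[OF bij_\<phi>, symmetric] by simp
    moreover have "inv_into (T_OP X X') \<phi> (\<phi> \<alpha>) = \<alpha>" if "\<alpha> \<in> T_OP X X'" for \<alpha>
      using bij_\<phi> that by (auto simp: bij_betw_def)
    ultimately show ?thesis by (simp add: matches_def)
  qed
  have abc': "\<exists>p\<in>Y'. \<exists>q\<in>Y'. \<exists>r\<in>Y'. p < q \<and> q < r"
  proof -
    have "\<theta> a < \<theta> b \<and> \<theta> b < \<theta> c \<or> \<theta> c < \<theta> b \<and> \<theta> b < \<theta> a"
      using \<theta>_monotone abc by (auto simp: monotone_on_def)
    then show ?thesis using abc(1-3)[THEN \<theta>_mem] by blast
  qed
  have "h ` X = Y"
  proof
    show "Y \<subseteq> h ` X"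
    proof
      fix y assume y: "y \<in> Y"
      then obtain x where x: "x \<in> X" "inv.matches y x" using abc' inv.ex_match by metis
      then have "matches x y" using inv_matches y by blast
      then show "y \<in> h ` X" using matches_unique[OF _ h(2)] h(1) x y by blast
    qed
  qed (use h in blast)
  moreover have "inj_on h X"
  proof (rule inj_onI)
    fix x x' assume xx': "x \<in> X" "x' \<in> X" "h x = h x'"
    then have "inv.matches (h x) x" "inv.matches (h x) x'" using h inv_matches by metis+
    then show "x = x'" using inv.matches_unique xx' by blast
  qed
  ultimately have bij: "bij_betw h X Y" by (simp add: bij_betw_def)
  have "strict_mono_on X h \<or> strict_antimono_on X h"
    using \<theta>_monotone matches_order[OF h(2) h(2)] h(1) by (auto simp: monotone_on_def)
  moreover have "h x = \<theta> x" if x: "x \<in> X'" for x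
  proof (rule matches_unique)
    show "matches x (h x)" "h x \<in> Y" using h x X'_sub by auto
    show "matches x (\<theta> x)" using equivariant x by (simp add: matches_def)
    show "\<theta> x \<in> Y" using \<theta>_mem x Y'_sub by blast
  qed
  then have "h ` X' = Y'" using bij_\<theta> by (auto simp: bij_betw_def)
  ultimately show ?thesis
    using order_isomorphismI[OF bij] order_anti_isomorphismI[OF bij] by blast
qed

end

section \<open>The induced action of an isomorphism\<close>

text \<open>
  Equivariance comes from the product of a constant map with \<open>\<alpha>\<close>: it is the constant map of the
  value under \<open>\<alpha>\<close>, so the action on points is right multiplication on constant maps.
\<close>

lemma ex_induced_action:
  fixes X X' :: "'a::linorder set" and Y Y' :: "'b::linorder set"
  assumes sub: "X' \<subseteq> X" "Y' \<subseteq> Y" and two: "\<exists>a\<in>X'. \<exists>b\<in>X'. a < b" and "Y' \<noteq> {}"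
    and bij: "bij_betw \<phi> (T_OP X X') (T_OP Y Y')"
    and hom: "\<And>\<alpha> \<beta>. \<alpha> \<in> T_OP X X' \<Longrightarrow> \<beta> \<in> T_OP X X' \<Longrightarrow>
      \<phi> (rcomp X \<alpha> \<beta>) = rcomp Y (\<phi> \<alpha>) (\<phi> \<beta>)"
  shows "\<exists>\<theta>. T_OP_isomorphism X X' Y Y' \<phi> \<theta>"
proof -
  let ?c = "\<lambda>a. \<lambda>x\<in>X. a" and ?d = "\<lambda>b. \<lambda>y\<in>Y. b"
  have "X' \<noteq> {}" using two by blast
  have c: "?c a \<in> T_OP X X'" if "a \<in> X'" for a using that sub by (intro T_OP_I) auto
  have d: "?d b \<in> T_OP Y Y'" if "b \<in> Y'" for b using that sub by (intro T_OP_I) auto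
  have img: "\<phi> ` T_OP X X' = T_OP Y Y'" and inj: "inj_on \<phi> (T_OP X X')"
    using bij by (auto simp: bij_betw_def)
  have zero_iff: "(\<exists>b\<in>Y'. \<phi> \<zeta> = ?d b) \<longleftrightarrow> (\<exists>a\<in>X'. \<zeta> = ?c a)" if \<zeta>: "\<zeta> \<in> T_OP X X'" for \<zeta>
  proof -
    have "(\<exists>b\<in>Y'. \<phi> \<zeta> = ?d b) \<longleftrightarrow> (\<forall>\<beta>\<in>T_OP Y Y'. rcomp Y \<beta> (\<phi> \<zeta>) = \<phi> \<zeta>)"
      using constant_iff_right_zero[OF sub(2) \<open>Y' \<noteq> {}\<close>] img \<zeta> by blast
    also have "\<dots> \<longleftrightarrow> (\<forall>\<alpha>\<in>T_OP X X'. \<phi> (rcomp X \<alpha> \<zeta>) = \<phi> \<zeta>)"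
      unfolding img[symmetric] using hom \<zeta> by simp
    also have "\<dots> \<longleftrightarrow> (\<forall>\<alpha>\<in>T_OP X X'. rcomp X \<alpha> \<zeta> = \<zeta>)"
      by (intro ball_cong refl inj_on_eq_iff[OF inj]) (simp_all add: rcomp_in_T_OP sub(1) \<zeta>)
    also have "\<dots> \<longleftrightarrow> (\<exists>a\<in>X'. \<zeta> = ?c a)"
      using constant_iff_right_zero[OF sub(1) \<open>X' \<noteq> {}\<close> \<zeta>] by blast
    finally show ?thesis .
  qed
  have "\<exists>b\<in>Y'. \<phi> (?c a) = ?d b" if "a \<in> X'" for a
    using zero_iff[OF c[OF that]] that by blast
  then obtain \<theta> where \<theta>: "\<And>a. a \<in> X' \<Longrightarrow> \<theta> a \<in> Y'" "\<And>a. a \<in> X' \<Longrightarrow> \<phi> (?c a) = ?d (\<theta> a)"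
    by metis
  have c_inj: "a = b" if "a \<in> X'" "b \<in> X'" "?c a = ?c b" for a b
    using that sub(1) by (metis restrict_apply' subsetD)
  have d_inj: "a = b" if "a \<in> Y'" "b \<in> Y'" "?d a = ?d b" for a b
    using that sub(2) by (metis restrict_apply' subsetD)
  have "inj_on \<theta> X'"
  proof (rule inj_onI)
    fix a b assume ab: "a \<in> X'" "b \<in> X'" "\<theta> a = \<theta> b"
    then have "\<phi> (?c a) = \<phi> (?c b)" using \<theta> by simp
    then show "a = b" using inj c ab c_inj by (meson inj_onD)
  qed
  moreover have "Y' \<subseteq> \<theta> ` X'"
  proof
    fix b assume b: "b \<in> Y'"
    obtain \<zeta> where \<zeta>: "\<zeta> \<in> T_OP X X'" "\<phi> \<zeta> = ?d b" using img d[OF b] by (metis imageE)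
    then obtain a where a: "a \<in> X'" "\<zeta> = ?c a" using zero_iff b by blast
    then show "b \<in> \<theta> ` X'" using \<zeta>(2) \<theta> b d_inj by (metis imageI)
  qed
  ultimately have bij\<theta>: "bij_betw \<theta> X' Y'" using \<theta>(1) by (auto simp: bij_betw_def)
  have "\<phi> \<alpha> (\<theta> a) = \<theta> (\<alpha> a)" if \<alpha>: "\<alpha> \<in> T_OP X X'" and a: "a \<in> X'" for \<alpha> a
  proof -
    have aX: "a \<in> X" "\<theta> a \<in> Y" "\<alpha> a \<in> X'" using a sub \<theta>(1) T_OP_app[OF \<alpha>] by blast+
    have "rcomp X (?c a) \<alpha> = ?c (\<alpha> a)" using aX by (auto simp: rcomp_def compose_def)
    then have "rcomp Y (?d (\<theta> a)) (\<phi> \<alpha>) = ?d (\<theta> (\<alpha> a))"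
      using hom[OF c[OF a] \<alpha>] \<theta> a aX by metis
    then have "rcomp Y (?d (\<theta> a)) (\<phi> \<alpha>) (\<theta> a) = ?d (\<theta> (\<alpha> a)) (\<theta> a)" by simp
    then show ?thesis using aX by (simp add: rcomp_app)
  qed
  then have "T_OP_isomorphism X X' Y Y' \<phi> \<theta>"
    using sub bij hom bij\<theta> two by unfold_locales auto
  then show ?thesis by blast
qed

section \<open>Conjugation by an order-isomorphism or order-anti-isomorphism\<close>

definition conjugate :: "'a set \<Rightarrow> 'b set \<Rightarrow> ('a \<Rightarrow> 'b) \<Rightarrow> ('a \<Rightarrow> 'a) \<Rightarrow> 'b \<Rightarrow> 'b" where
  "conjugate X Y \<theta> \<alpha> = (\<lambda>y\<in>Y. \<theta> (\<alpha> (inv_into X \<theta> y)))"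

text \<open>
  An order-reversing \<open>\<theta>\<close> is used twice, once inverted, so the two reversals cancel.
\<close>

lemma conjugate_in_T_OP:
  assumes "order_isomorphism X Y \<theta> \<or> order_anti_isomorphism X Y \<theta>"
    and sub: "X' \<subseteq> X" and img: "\<theta> ` X' = Y'" and \<alpha>: "\<alpha> \<in> T_OP X X'"
  shows "conjugate X Y \<theta> \<alpha> \<in> T_OP Y Y'"
  unfolding conjugate_def
proof (rule T_OP_I)
  let ?\<eta> = "inv_into X \<theta>"
  have bij: "bij_betw \<theta> X Y"
    using assms(1) by (auto simp: order_isomorphism_def order_anti_isomorphism_def)
  then have \<eta>: "?\<eta> y \<in> X" if "y \<in> Y" for y
    using that by (auto simp: bij_betw_def inv_into_into)
  have \<alpha>\<eta>: "\<alpha> (?\<eta> y) \<in> X'" if "y \<in> Y" for y using T_OP_app[OF \<alpha>] \<eta> that by blast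
  show "Y' \<subseteq> Y" using img sub bij by (auto simp: bij_betw_def)
  show "\<theta> (\<alpha> (?\<eta> y)) \<in> Y'" if "y \<in> Y" for y using img \<alpha>\<eta>[OF that] by blast
  show "\<theta> (\<alpha> (?\<eta> u)) \<le> \<theta> (\<alpha> (?\<eta> v))" if uv: "u \<in> Y" "v \<in> Y" "u \<le> v" for u v
    using assms(1)
  proof
    assume "order_isomorphism X Y \<theta>"
    then have "mono_on X \<theta>" "mono_on Y ?\<eta>" by (auto simp: order_isomorphism_def)
    then show ?thesis
      using uv \<alpha>\<eta> \<eta> sub T_OP_mono[OF \<alpha>] by (meson monotone_onD subsetD)
  next
    assume "order_anti_isomorphism X Y \<theta>"
    then have "antimono_on X \<theta>" "antimono_on Y ?\<eta>" by (auto simp: order_anti_isomorphism_def)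
    then show ?thesis
      using uv \<alpha>\<eta> \<eta> sub T_OP_mono[OF \<alpha>] by (meson monotone_onD subsetD)
  qed
qed

lemma order_isomorphism_inv:
  assumes "order_isomorphism X Y \<theta> \<or> order_anti_isomorphism X Y \<theta>"
  shows "order_isomorphism Y X (inv_into X \<theta>) \<or> order_anti_isomorphism Y X (inv_into X \<theta>)"
proof -
  have bij: "bij_betw \<theta> X Y"
    using assms(1) by (auto simp: order_isomorphism_def order_anti_isomorphism_def)
  have "inv_into Y (inv_into X \<theta>) x = \<theta> x" if "x \<in> X" for x
    using bij that by (simp add: inv_into_inv_into_eq)
  then show ?thesis
    using assms bij_betw_inv_into[OF bij]
    by (auto simp: order_isomorphism_def order_anti_isomorphism_def monotone_on_def)
qed

lemma conjugate_inverse: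
  assumes bij: "bij_betw \<theta> X Y" and sub: "X' \<subseteq> X" and \<alpha>: "\<alpha> \<in> T_OP X X'"
  shows "conjugate Y X (inv_into X \<theta>) (conjugate X Y \<theta> \<alpha>) = \<alpha>"
proof
  fix x
  show "conjugate Y X (inv_into X \<theta>) (conjugate X Y \<theta> \<alpha>) x = \<alpha> x"
  proof (cases "x \<in> X")
    case True
    then have "\<alpha> x \<in> X" "\<theta> x \<in> Y" using T_OP_app[OF \<alpha>] sub bij by (auto simp: bij_betw_def)
    then show ?thesis
      using True bij by (simp add: conjugate_def inv_into_inv_into_eq bij_betw_inv_into_left)
  next
    case False
    then show ?thesis using \<alpha> by (auto simp: conjugate_def T_OP_def PiE_def extensional_def)
  qed
qed

lemma isomorphic_if_order_isomorphism:
  assumes iso: "order_isomorphism X Y \<theta> \<or> order_anti_isomorphism X Y \<theta>"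
    and sub: "X' \<subseteq> X" and img: "\<theta> ` X' = Y'"
  shows "semigroups_isomorphic (T_OP X X') (rcomp X) (T_OP Y Y') (rcomp Y)"
proof -
  let ?\<eta> = "inv_into X \<theta>"
  have bij: "bij_betw \<theta> X Y"
    using iso by (auto simp: order_isomorphism_def order_anti_isomorphism_def)
  have sub': "Y' \<subseteq> Y" using img sub bij by (auto simp: bij_betw_def)
  have img': "?\<eta> ` Y' = X'" using img sub bij by (auto simp: bij_betw_def inv_into_image_cancel)
  have undo: "conjugate X Y \<theta> (conjugate Y X ?\<eta> \<beta>) = \<beta>" if \<beta>: "\<beta> \<in> T_OP Y Y'" for \<beta>
  proof
    fix y
    show "conjugate X Y \<theta> (conjugate Y X ?\<eta> \<beta>) y = \<beta> y"
    proof (cases "y \<in> Y")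
      case True
      then have "?\<eta> y \<in> X" "\<beta> y \<in> Y"
        using T_OP_app[OF \<beta>] sub' bij by (auto simp: bij_betw_def inv_into_into)
      then show ?thesis
        using True bij_betw_inv_into_left[OF bij_betw_inv_into[OF bij]] bij_betw_inv_into_right[OF bij]
        by (simp add: conjugate_def)
    next
      case False
      then show ?thesis using \<beta> by (auto simp: conjugate_def T_OP_def PiE_def extensional_def)
    qed
  qed
  have "bij_betw (conjugate X Y \<theta>) (T_OP X X') (T_OP Y Y')"
    using conjugate_in_T_OP[OF iso sub img] conjugate_inverse[OF bij sub] undo
      conjugate_in_T_OP[OF order_isomorphism_inv[OF iso] sub' img']
    by (intro bij_betw_byWitness[where f' = "conjugate Y X ?\<eta>"]) auto
  moreover have "conjugate X Y \<theta> (rcomp X \<alpha> \<beta>) = rcomp Y (conjugate X Y \<theta> \<alpha>) (conjugate X Y \<theta> \<beta>)"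
    if \<alpha>: "\<alpha> \<in> T_OP X X'" for \<alpha> \<beta>
  proof
    fix y
    show "conjugate X Y \<theta> (rcomp X \<alpha> \<beta>) y = rcomp Y (conjugate X Y \<theta> \<alpha>) (conjugate X Y \<theta> \<beta>) y"
    proof (cases "y \<in> Y")
      case True
      then have "?\<eta> y \<in> X" using bij by (auto simp: bij_betw_def inv_into_into)
      moreover from this have "\<alpha> (?\<eta> y) \<in> X" using T_OP_app[OF \<alpha>] sub by blast
      moreover from this have "\<theta> (\<alpha> (?\<eta> y)) \<in> Y" using bij by (auto simp: bij_betw_def)
      ultimately show ?thesis
        using True bij by (simp add: conjugate_def rcomp_app bij_betw_inv_into_left)
    qed (simp add: conjugate_def rcomp_def compose_def)
  qed
  ultimately show ?thesis unfolding semigroups_isomorphic_def by blast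
qed

section \<open>The classification\<close>

lemma three_increasing:
  fixes A :: "'a::linorder set"
  assumes "infinite A \<or> card A \<ge> 3"
  shows "\<exists>a\<in>A. \<exists>b\<in>A. \<exists>c\<in>A. a < b \<and> b < c"
proof -
  obtain B where B: "B \<subseteq> A" "card B = 3" "finite B"
    using assms by (metis infinite_arbitrarily_large obtain_subset_with_card_n)
  then obtain a b c where abc: "B = {a, b, c}" "a \<noteq> b" "b \<noteq> c" "a \<noteq> c"
    by (auto simp: card_3_iff)
  then have "a \<in> A" "b \<in> A" "c \<in> A" using B by auto
  moreover have "a < b \<or> b < a" "b < c \<or> c < b" "a < c \<or> c < a" using abc by auto
  ultimately show ?thesis by blast
qed

theorem theorem4p3:
  fixes X X' :: "'a::linorder set" and Y Y' :: "'b::linorder set"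
  assumes "X' \<subseteq> X" and "Y' \<subseteq> Y"
    and "infinite X' \<or> card X' > 1" and "infinite Y' \<or> card Y' > 1"
    and "infinite X' \<or> card X' \<ge> 3"
  shows "semigroups_isomorphic (T_OP X X') (rcomp X) (T_OP Y Y') (rcomp Y) \<longleftrightarrow>
    (\<exists>\<theta>. (order_isomorphism X Y \<theta> \<or> order_anti_isomorphism X Y \<theta>) \<and> \<theta> ` X' = Y')"
proof
  assume "semigroups_isomorphic (T_OP X X') (rcomp X) (T_OP Y Y') (rcomp Y)"
  then obtain \<phi> where \<phi>: "bij_betw \<phi> (T_OP X X') (T_OP Y Y')"
    "\<And>\<alpha> \<beta>. \<alpha> \<in> T_OP X X' \<Longrightarrow> \<beta> \<in> T_OP X X' \<Longrightarrow>
      \<phi> (rcomp X \<alpha> \<beta>) = rcomp Y (\<phi> \<alpha>) (\<phi> \<beta>)"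
    unfolding semigroups_isomorphic_def by blast
  obtain a b c where abc: "a \<in> X'" "b \<in> X'" "c \<in> X'" "a < b" "b < c"
    using three_increasing[OF assms(5)] by blast
  have "Y' \<noteq> {}" using assms(4) by auto
  then obtain \<theta> where "T_OP_isomorphism X X' Y Y' \<phi> \<theta>"
    using ex_induced_action[OF assms(1,2) _ _ \<phi>] abc by blast
  then show "\<exists>\<theta>. (order_isomorphism X Y \<theta> \<or> order_anti_isomorphism X Y \<theta>) \<and> \<theta> ` X' = Y'"
    using T_OP_isomorphism.ex_extension abc by blast
next
  assume "\<exists>\<theta>. (order_isomorphism X Y \<theta> \<or> order_anti_isomorphism X Y \<theta>) \<and> \<theta> ` X' = Y'"
  then show "semigroups_isomorphic (T_OP X X') (rcomp X) (T_OP Y Y') (rcomp Y)"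
    using isomorphic_if_order_isomorphism assms(1) by blast
qed

end
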